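(* Let $B$ be a finitely generated, perfect group and let $\mathcal{S}=((\Omega_i)_{i\in\mathbb{N}},(\phi_i)_{i\geq2})$ be a flexible $B$-telescope such that each $\Omega_i$ is a finitely generated non-abelian simple group. If the head $Q_{\mathcal{S}}$ is simple, then $G_{\mathcal{S}}$ is a $t$-group.
   Context: A group is a $t$-group if all of its subnormal subgroups are normal; equivalently, normality is a transitive relation among its subgroups. Notation: $g^h=h^{-1}gh$, $[g,h]=ghg^{-1}h^{-1}$, $\mathbb{N}=\{1,2,\dots\}$. For a group $B$, a $B$-telescope $\mathcal{S}=((\Omega_i)_{i\in\mathbb{N}},(\phi_i)_{i\geq2})$ consists of a directed system of groups $\Omega_i$ with homomorphisms $\iota_{i,j}\colon\Omega_i\to\Omega_j$ for $i<j$ (with $\iota_{j,k}\circ\iota_{i,j}=\iota_{i,k}$, and $\iota_{i,i}=\mathrm{id}$), together with homomorphisms $\phi_i\colon B\to\Omega_i$ for $i\geq2$ with images $B_i=\phi_i(B)$, such that $\Omega_i=\langle hB_ih^{-1}\mid h\in\iota_{i-1,i}(\Omega_{i-1})\rangle$ for all $i\geq2$ and $[\iota_{i,j}(B_i),B_j]=1$ for all $2\leq i<j$. Write $B_{i,j}=\iota_{i,j}(B_i)$. $\mathcal{S}$ is flexible if for all $i\in\mathbb{N}$ there is $\alpha_i\in\Omega_i$ such that, with $\alpha_{i,j}=\iota_{i,j}(\alpha_i)$: (F1) $[\alpha_{i,i+1},B_{i+1}]=1$ for all $i\geq1$; (F2) $[B_{k,m}^{\alpha_{i,m}},B_{\ell,m}]=1$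 for all $k,\ell\geq i+2$ and $m\geq k,\ell$; (F3) $[B_{k,m}^{\alpha_{i,m}},B_{\ell,m}^{\alpha_{j,m}}]=1$ for all $k\geq i+2$, $\ell\geq j+2$, $i>j$ and $m\geq k,\ell$. Let $P_{\mathcal{S}}=\prod_{i=1}^\infty\Omega_i$ with projections $\pi_i$. Let $\Delta_i\colon\Omega_i\to P_{\mathcal{S}}$, $\omega\mapsto(1,\dots,1,\omega,\iota_{i,i+1}(\omega),\iota_{i,i+2}(\omega),\dots)$ with $i-1$ leading $1$'s. For $g\in B$ let $\tilde g^{[1]}\in P_{\mathcal{S}}$ have $\pi_1(\tilde g^{[1]})=1$ and $\pi_i(\tilde g^{[1]})=\prod_{k=2}^i\iota_{k,i}(\phi_k(g))$ for $i>1$ (the factors commute); $C^{[1]}=\{\tilde g^{[1]}\mid g\in B\}$. The group of $\mathcal{S}$ is $G_{\mathcal{S}}=\langle\Delta_1(\Omega_1),C^{[1]}\rangle$, the huge group is $\widetilde G_{\mathcal{S}}=\langle\bigcup_{i\geq1}\Delta_i(\Omega_i)\cup C^{[1]}\rangle$; the latter contains $\bigoplus_{i=1}^\infty\Omega_i$ as a normal subgroup and the head is $Q_{\mathcal{S}}=\widetilde G_{\mathcal{S}}/\bigoplus_{i=1}^\infty\Omega_i$. (If $\mathcal{S}$ is flexible and $B$ is perfect, then $G_{\mathcal{S}}=\widetilde G_{\mathcal{S}}$.) *)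

theory Defs
  imports "HOL-Algebra.Product_Groups"
begin

section \<open>Group-theoretic notions\<close>

definition finitely_generated :: "('a, 'm) monoid_scheme \<Rightarrow> bool" where
  "finitely_generated G \<longleftrightarrow>
     group G \<and> (\<exists>S. finite S \<and> S \<subseteq> carrier G \<and> generate G S = carrier G)"

definition perfect_group :: "('a, 'm) monoid_scheme \<Rightarrow> bool" where
  "perfect_group G \<longleftrightarrow> group G \<and> derived G (carrier G) = carrier G"

text \<open>The locale \<open>simple_group\<close> of HOL-Algebra demands \<open>order G > 1\<close>; since \<open>order\<close> is a
  \<open>card\<close>, which is 0 on infinite sets, that locale only covers finite groups.
  The groups below are typically infinite.\<close>

definition simple_grp :: "('a, 'm) monoid_scheme \<Rightarrow> bool" where
  "simple_grp G \<longleftrightarrow>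
     group G \<and> carrier G \<noteq> {\<one>\<^bsub>G\<^esub>} \<and> (\<forall>N. N \<lhd> G \<longrightarrow> N = carrier G \<or> N = {\<one>\<^bsub>G\<^esub>})"

inductive subnormal :: "('a, 'm) monoid_scheme \<Rightarrow> 'a set \<Rightarrow> bool" for G where
  whole: "subnormal G (carrier G)"
| step: "subnormal G K \<Longrightarrow> H \<lhd> G\<lparr>carrier := K\<rparr> \<Longrightarrow> subnormal G H"

definition t_group :: "('a, 'm) monoid_scheme \<Rightarrow> bool" where
  "t_group G \<longleftrightarrow> group G \<and> (\<forall>H. subnormal G H \<longrightarrow> H \<lhd> G)"

definition commutator :: "('a, 'm) monoid_scheme \<Rightarrow> 'a \<Rightarrow> 'a \<Rightarrow> 'a" where
  "commutator G g h = g \<otimes>\<^bsub>G\<^esub> h \<otimes>\<^bsub>G\<^esub> inv\<^bsub>G\<^esub> g \<otimes>\<^bsub>G\<^esub> inv\<^bsub>G\<^esub> h"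

definition commutator_subgroup :: "('a, 'm) monoid_scheme \<Rightarrow> 'a set \<Rightarrow> 'a set \<Rightarrow> 'a set" where
  "commutator_subgroup G X Y = generate G {commutator G x y | x y. x \<in> X \<and> y \<in> Y}"

definition conj_set :: "('a, 'm) monoid_scheme \<Rightarrow> 'a set \<Rightarrow> 'a \<Rightarrow> 'a set" where
  "conj_set G X h = (\<lambda>x. inv\<^bsub>G\<^esub> h \<otimes>\<^bsub>G\<^esub> x \<otimes>\<^bsub>G\<^esub> h) ` X"


section \<open>Telescopes\<close>

text \<open>The indices \<open>i\<close> of \<open>\<Omega> i\<close> range over \<open>i \<ge> 1\<close>; the values of \<open>\<Omega>\<close>, \<open>\<iota>\<close> and \<open>\<phi>\<close> at
  other indices are irrelevant.\<close>

definition tel_image ::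
  "('b, 'n) monoid_scheme \<Rightarrow> (nat \<Rightarrow> nat \<Rightarrow> 'a \<Rightarrow> 'a) \<Rightarrow> (nat \<Rightarrow> 'b \<Rightarrow> 'a) \<Rightarrow> nat \<Rightarrow> nat \<Rightarrow> 'a set"
  where \<comment> \<open>\<open>B\<^sub>i\<^sub>,\<^sub>j = \<iota>\<^sub>i\<^sub>,\<^sub>j (\<phi>\<^sub>i (B))\<close>\<close>
  "tel_image B \<iota> \<phi> i j = \<iota> i j ` \<phi> i ` carrier B"

locale telescope =
  fixes B :: "('b, 'n) monoid_scheme"
    and \<Omega> :: "nat \<Rightarrow> ('a, 'm) monoid_scheme"
    and \<iota> :: "nat \<Rightarrow> nat \<Rightarrow> 'a \<Rightarrow> 'a"
    and \<phi> :: "nat \<Rightarrow> 'b \<Rightarrow> 'a"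
  assumes group_B: "group B"
    and group_Omega: "\<And>i. 1 \<le> i \<Longrightarrow> group (\<Omega> i)"
    and iota_hom: "\<And>i j. 1 \<le> i \<Longrightarrow> i < j \<Longrightarrow> \<iota> i j \<in> hom (\<Omega> i) (\<Omega> j)"
    and iota_id: "\<And>i x. 1 \<le> i \<Longrightarrow> x \<in> carrier (\<Omega> i) \<Longrightarrow> \<iota> i i x = x"
    and iota_comp: "\<And>i j k x. 1 \<le> i \<Longrightarrow> i < j \<Longrightarrow> j < k \<Longrightarrow> x \<in> carrier (\<Omega> i) \<Longrightarrow>
          \<iota> j k (\<iota> i j x) = \<iota> i k x"
    and phi_hom: "\<And>i. 2 \<le> i \<Longrightarrow> \<phi> i \<in> hom B (\<Omega> i)"
    and Omega_generated: "\<And>i. 2 \<le> i \<Longrightarrow>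
          carrier (\<Omega> i) =
          generate (\<Omega> i) {h \<otimes>\<^bsub>\<Omega> i\<^esub> b \<otimes>\<^bsub>\<Omega> i\<^esub> inv\<^bsub>\<Omega> i\<^esub> h | h b.
            h \<in> \<iota> (i - 1) i ` carrier (\<Omega> (i - 1)) \<and> b \<in> \<phi> i ` carrier B}"
    and images_commute: "\<And>i j. 2 \<le> i \<Longrightarrow> i < j \<Longrightarrow>
          commutator_subgroup (\<Omega> j) (tel_image B \<iota> \<phi> i j) (\<phi> j ` carrier B) = {\<one>\<^bsub>\<Omega> j\<^esub>}"

locale flexible_telescope = telescope +
  assumes flexible: "\<exists>\<alpha>. (\<forall>i\<ge>1. \<alpha> i \<in> carrier (\<Omega> i)) \<and>
    (\<forall>i\<ge>1. commutator_subgroup (\<Omega> (i + 1))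
       {\<iota> i (i + 1) (\<alpha> i)} (\<phi> (i + 1) ` carrier B) = {\<one>\<^bsub>\<Omega> (i + 1)\<^esub>}) \<and>
    (\<forall>i\<ge>1. \<forall>k\<ge>i + 2. \<forall>l\<ge>i + 2. \<forall>m. k \<le> m \<and> l \<le> m \<longrightarrow>
       commutator_subgroup (\<Omega> m)
         (conj_set (\<Omega> m) (tel_image B \<iota> \<phi> k m) (\<iota> i m (\<alpha> i)))
         (tel_image B \<iota> \<phi> l m) = {\<one>\<^bsub>\<Omega> m\<^esub>}) \<and>
    (\<forall>i\<ge>1. \<forall>j\<ge>1. \<forall>k\<ge>i + 2. \<forall>l\<ge>j + 2. \<forall>m. j < i \<and> k \<le> m \<and> l \<le> m \<longrightarrow>
       commutator_subgroup (\<Omega> m)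
         (conj_set (\<Omega> m) (tel_image B \<iota> \<phi> k m) (\<iota> i m (\<alpha> i)))
         (conj_set (\<Omega> m) (tel_image B \<iota> \<phi> l m) (\<iota> j m (\<alpha> j))) = {\<one>\<^bsub>\<Omega> m\<^esub>})"

abbreviation tel_product :: "(nat \<Rightarrow> ('a, 'm) monoid_scheme) \<Rightarrow> (nat \<Rightarrow> 'a) monoid" where
  "tel_product \<Omega> \<equiv> product_group {1..} \<Omega>"

definition tel_diag ::
  "(nat \<Rightarrow> ('a, 'm) monoid_scheme) \<Rightarrow> (nat \<Rightarrow> nat \<Rightarrow> 'a \<Rightarrow> 'a) \<Rightarrow> nat \<Rightarrow> 'a \<Rightarrow> nat \<Rightarrow> 'a" where
  "tel_diag \<Omega> \<iota> i \<omega> = (\<lambda>j\<in>{1..}. if j < i then \<one>\<^bsub>\<Omega> j\<^esub> else \<iota> i j \<omega>)"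

text \<open>The \<open>i\<close>-th entry below is the product over \<open>k = 2, \<dots>, i\<close> in increasing order; the
  factors commute in a telescope, but \<open>finprod\<close> is only meaningful in commutative monoids.
  For \<open>i = 1\<close> the product is empty.\<close>

definition tel_tilde ::
  "(nat \<Rightarrow> ('a, 'm) monoid_scheme) \<Rightarrow> (nat \<Rightarrow> nat \<Rightarrow> 'a \<Rightarrow> 'a) \<Rightarrow> (nat \<Rightarrow> 'b \<Rightarrow> 'a) \<Rightarrow>
   'b \<Rightarrow> nat \<Rightarrow> 'a" where
  "tel_tilde \<Omega> \<iota> \<phi> g =
     (\<lambda>i\<in>{1..}. foldr (\<lambda>k y. \<iota> k i (\<phi> k g) \<otimes>\<^bsub>\<Omega> i\<^esub> y) [2..<Suc i] \<one>\<^bsub>\<Omega> i\<^esub>)"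

definition tel_group ::
  "('b, 'n) monoid_scheme \<Rightarrow> (nat \<Rightarrow> ('a, 'm) monoid_scheme) \<Rightarrow> (nat \<Rightarrow> nat \<Rightarrow> 'a \<Rightarrow> 'a) \<Rightarrow>
   (nat \<Rightarrow> 'b \<Rightarrow> 'a) \<Rightarrow> (nat \<Rightarrow> 'a) monoid" where
  "tel_group B \<Omega> \<iota> \<phi> = subgroup_generated (tel_product \<Omega>)
     (tel_diag \<Omega> \<iota> 1 ` carrier (\<Omega> 1) \<union> tel_tilde \<Omega> \<iota> \<phi> ` carrier B)"

definition tel_huge_group ::
  "('b, 'n) monoid_scheme \<Rightarrow> (nat \<Rightarrow> ('a, 'm) monoid_scheme) \<Rightarrow> (nat \<Rightarrow> nat \<Rightarrow> 'a \<Rightarrow> 'a) \<Rightarrow>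
   (nat \<Rightarrow> 'b \<Rightarrow> 'a) \<Rightarrow> (nat \<Rightarrow> 'a) monoid" where
  "tel_huge_group B \<Omega> \<iota> \<phi> = subgroup_generated (tel_product \<Omega>)
     ((\<Union>i\<in>{1..}. tel_diag \<Omega> \<iota> i ` carrier (\<Omega> i)) \<union> tel_tilde \<Omega> \<iota> \<phi> ` carrier B)"

definition tel_head ::
  "('b, 'n) monoid_scheme \<Rightarrow> (nat \<Rightarrow> ('a, 'm) monoid_scheme) \<Rightarrow> (nat \<Rightarrow> nat \<Rightarrow> 'a \<Rightarrow> 'a) \<Rightarrow>
   (nat \<Rightarrow> 'b \<Rightarrow> 'a) \<Rightarrow> (nat \<Rightarrow> 'a) set monoid" where
  "tel_head B \<Omega> \<iota> \<phi> = tel_huge_group B \<Omega> \<iota> \<phi> Mod carrier (sum_group {1..} \<Omega>)"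

end

theory Submission
  imports Defs
begin

text \<open>
  Write \<open>P\<close> for the full product of the groups \<open>\<Omega> i\<close>, \<open>N\<close> for their direct sum and \<open>G\<close> for the
  group of the telescope. The proof has two independent halves.

  The first half knows nothing about telescopes: \<open>G\<close> is any subgroup of a product of non-abelian
  simple groups that contains \<open>N\<close> and has \<open>G / N\<close> simple (\<open>t_group_extending_direct_sum\<close>). Call a
  set \<open>H\<close> factor-closed if it contains the whole factor \<open>\<Omega> i\<close> as soon as some element of \<open>H\<close> has a
  nontrivial \<open>i\<close>-th entry. Because simple non-abelian groups have trivial centre, commutators with
  elements of \<open>\<Omega> i\<close> show that this property descends from a subgroup to its normal subgroups
  (\<open>factor_closed_normal\<close>), so every subnormal subgroup \<open>H\<close> of \<open>G\<close> has it. Moreover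
  the image of \<open>H\<close> in the simple group \<open>G / N\<close> is trivial or everything. In the first case \<open>H\<close> lies
  in \<open>N\<close>, hence is the direct sum of the factors onto which it projects nontrivially, which is normal
  in \<open>P\<close>. In the second case \<open>G = N H\<close>, and it suffices that \<open>N\<close> normalises \<open>H\<close>: each factor is either contained in \<open>H\<close>
  or commutes with \<open>H\<close>. In both cases the technical tool is that an element of finite support lies in
  \<open>H\<close> once \<open>H\<close> is nontrivial at every index of the support (\<open>finite_support_mem\<close>).

  The second half shows that \<open>G\<close> is the huge group and contains \<open>N\<close>. By induction on \<open>i\<close>, the group
  \<open>G\<close> contains the diagonal copy \<open>\<Delta>\<^sub>i(\<Omega> i)\<close> and the tails of the elements \<open>tel_tilde \<Omega> \<iota> \<phi> g\<close>
  in which the factors \<open>\<phi> k g\<close> with \<open>k \<le> i\<close> are dropped. For the induction step the tail of \<open>g\<close>,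
  conjugated by \<open>\<Delta>\<^sub>i(\<alpha>\<^sub>i)\<close>, has an unchanged leading factor \<open>\<phi> (i + 1) g\<close> by (F1), while by (F2) its
  later factors commute with those of the tail of \<open>h\<close>. The commutator of these two elements is thus
  the diagonal image of \<open>\<phi> (i + 1)\<close> of the commutator of \<open>g\<close> and \<open>h\<close> (\<open>tail_commutator\<close>). Since \<open>B\<close>
  is perfect, such elements generate the diagonal copy of \<open>\<phi> (i + 1) ` B\<close>, and conjugation by
  \<open>\<Delta>\<^sub>i(\<Omega> i)\<close> gives all of \<open>\<Delta>\<^sub>i\<^sub>+\<^sub>1(\<Omega> (i + 1))\<close>. Finally the factor \<open>\<Omega> i\<close> itself consists of the
  quotients of an element of \<open>\<Delta>\<^sub>i(\<Omega> i)\<close> by its image in \<open>\<Delta>\<^sub>i\<^sub>+\<^sub>1(\<Omega> (i + 1))\<close>.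
\<close>

section \<open>Simple groups and subnormal subgroups\<close>

lemma (in group) inv_commute:
  assumes "x \<otimes> y = y \<otimes> x" "x \<in> carrier G" "y \<in> carrier G"
  shows "inv x \<otimes> y = y \<otimes> inv x"
  using assms by (metis inv_closed inv_solve_left inv_solve_right m_assoc m_closed)

text \<open>The centre is a normal subgroup, and it is not the whole group.\<close>

lemma simple_nonabelian_noncommuting:
  fixes G (structure)
  assumes "simple_grp G" "\<not> comm_group G" "x \<in> carrier G" "x \<noteq> \<one>\<^bsub>G\<^esub>"
  obtains y where "y \<in> carrier G" "x \<otimes>\<^bsub>G\<^esub> y \<noteq> y \<otimes>\<^bsub>G\<^esub> x"
proof -
  interpret group G
    using assms(1) by (simp add: simple_grp_def)
  define Z where "Z = {z \<in> carrier G. \<forall>y\<in>carrier G. z \<otimes> y = y \<otimes> z}"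
  have "Z \<lhd> G"
  proof (rule normal_invI)
    show "subgroup Z G"
    proof (rule subgroupI)
      show "inv z \<in> Z" if "z \<in> Z" for z
        using that unfolding Z_def by (blast intro: inv_commute)
      show "z \<otimes> w \<in> Z" if "z \<in> Z" "w \<in> Z" for z w
      proof -
        have "z \<otimes> w \<otimes> y = y \<otimes> (z \<otimes> w)" if "y \<in> carrier G" for y
        proof -
          have zw: "z \<in> carrier G" "w \<in> carrier G" "z \<otimes> y = y \<otimes> z" "w \<otimes> y = y \<otimes> w"
            using \<open>z \<in> Z\<close> \<open>w \<in> Z\<close> that unfolding Z_def by blast+
          have "z \<otimes> w \<otimes> y = z \<otimes> (y \<otimes> w)"
            using zw(1,2,4) that by (simp add: m_assoc)
          also have "\<dots> = y \<otimes> z \<otimes> w"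
            using zw(1,2,3) that by (simp flip: m_assoc)
          finally show ?thesis
            using zw(1,2) that by (simp add: m_assoc)
        qed
        with that show ?thesis unfolding Z_def by blast
      qed
    qed (auto simp: Z_def)
    show "x \<otimes> h \<otimes> inv x \<in> Z" if "x \<in> carrier G" "h \<in> Z" for x h
    proof -
      have h: "h \<in> carrier G" "x \<otimes> h = h \<otimes> x" using that unfolding Z_def by force+
      then have "x \<otimes> h \<otimes> inv x = h" using that(1) by (simp add: m_assoc)
      with that show ?thesis by simp
    qed
  qed
  then have "Z = carrier G \<or> Z = {\<one>}"
    using assms(1) by (simp add: simple_grp_def)
  moreover have "Z \<noteq> carrier G"
    using assms(2) group_comm_groupI by (auto simp: Z_def)
  ultimately have "x \<notin> Z" using assms(4) by simp
  then show thesis using that assms(3) unfolding Z_def by blast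
qed

lemma subnormal_imp_subgroup:
  assumes "group G" "subnormal G H"
  shows "subgroup H G"
  using assms(2)
proof induction
  case whole
  show ?case using assms(1) by (rule group.subgroup_self)
next
  case (step K H)
  then show ?case
    using assms(1) group.incl_subgroup normal_imp_subgroup by blast
qed

text \<open>The inverse is taken in the ambient group, which spares later proofs the conversion from the
  inverse in the restricted group.\<close>

lemma normal_conj_closed:
  assumes "group G" "subgroup K G" "H \<lhd> G\<lparr>carrier := K\<rparr>" "k \<in> K" "h \<in> H"
  shows "k \<otimes>\<^bsub>G\<^esub> h \<otimes>\<^bsub>G\<^esub> inv\<^bsub>G\<^esub> k \<in> H"
proof -
  have "k \<otimes>\<^bsub>G\<^esub> h \<otimes>\<^bsub>G\<^esub> inv\<^bsub>G\<lparr>carrier := K\<rparr>\<^esub> k \<in> H"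
    using normal.inv_op_closed2[OF assms(3), of k h] assms(4,5) by simp
  then show ?thesis
    using group.m_inv_consistent[OF assms(1,2,4)] by simp
qed

text \<open>Going down a subnormal chain, the image stays everything until it becomes trivial, since
  each term maps to a normal subgroup of the image of the previous one.\<close>

lemma subnormal_image_simple:
  assumes "group_hom G Q q" "q ` carrier G = carrier Q" "simple_grp Q" "subnormal G H"
  shows "q ` H = {\<one>\<^bsub>Q\<^esub>} \<or> q ` H = carrier Q"
  using assms(4)
proof induction
  case whole
  show ?case using assms(2) by simp
next
  case (step K H)
  interpret q: group_hom G Q q by (rule assms(1))
  have K: "subgroup K G"
    using step.hyps(1) q.G.is_group by (rule subnormal_imp_subgroup[rotated])
  have H: "subgroup H G"
    using step.hyps q.G.is_group by (blast intro: subnormal_imp_subgroup subnormal.step)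
  have HK: "H \<subseteq> K"
    using normal_imp_subgroup[OF step.hyps(2)] subgroup.subset by force
  from step.IH show ?case
  proof
    assume "q ` K = {\<one>\<^bsub>Q\<^esub>}"
    moreover have "q ` H \<noteq> {}" using subgroup.one_closed[OF H] by blast
    ultimately have "q ` H = {\<one>\<^bsub>Q\<^esub>}"
      using image_mono[OF HK] subset_singletonD by metis
    then show ?thesis ..
  next
    assume onto: "q ` K = carrier Q"
    have "group_hom (G\<lparr>carrier := K\<rparr>) Q q"
      using q.G.subgroup_imp_group[OF K] subgroup.subset[OF K]
      by (auto simp: group_hom_def group_hom_axioms_def hom_def subset_iff q.H.is_group)
    then have "q ` H \<lhd> Q"
      using normal.surj_hom_normal_subgroup[OF step.hyps(2)] onto by simp
    then show ?thesis
      using assms(3) by (auto simp: simple_grp_def)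
  qed
qed

section \<open>Groups between a direct sum and a direct product\<close>

definition factor_embed :: "'i set \<Rightarrow> ('i \<Rightarrow> ('a, 'm) monoid_scheme) \<Rightarrow> 'i \<Rightarrow> 'a \<Rightarrow> 'i \<Rightarrow> 'a" where
  "factor_embed I \<Omega> i \<omega> = (\<lambda>j\<in>I. if j = i then \<omega> else \<one>\<^bsub>\<Omega> j\<^esub>)"

text \<open>For a subgroup \<open>H\<close> of \<open>product_group I \<Omega>\<close>, this says that the direct sum of the factors on
  which \<open>H\<close> projects nontrivially is contained in \<open>H\<close>.\<close>

definition factor_closed :: "'i set \<Rightarrow> ('i \<Rightarrow> ('a, 'm) monoid_scheme) \<Rightarrow> ('i \<Rightarrow> 'a) set \<Rightarrow> bool" where
  "factor_closed I \<Omega> H \<longleftrightarrow>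
     (\<forall>x\<in>H. \<forall>i\<in>I. x i \<noteq> \<one>\<^bsub>\<Omega> i\<^esub> \<longrightarrow> factor_embed I \<Omega> i ` carrier (\<Omega> i) \<subseteq> H)"

lemma factor_embed_hom:
  assumes "\<And>i. i \<in> I \<Longrightarrow> group (\<Omega> i)" "i \<in> I"
  shows "group_hom (\<Omega> i) (product_group I \<Omega>) (factor_embed I \<Omega> i)"
  unfolding group_hom_def group_hom_axioms_def
  using assms by (auto simp: hom_def factor_embed_def group.is_monoid monoid.m_closed
      intro!: product_group ext split: if_splits)

text \<open>An element of finite support is a finite product of its entries, each of which lies in \<open>H\<close>. The induction
  splits off one entry at a time.\<close>

lemma finite_support_mem:
  assumes grp: "\<And>i. i \<in> I \<Longrightarrow> group (\<Omega> i)"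
    and H: "subgroup H (product_group I \<Omega>)" "factor_closed I \<Omega> H"
    and fin: "finite {i \<in> I. x i \<noteq> \<one>\<^bsub>\<Omega> i\<^esub>}"
    and x: "x \<in> (\<Pi>\<^sub>E i\<in>I. carrier (\<Omega> i))"
    and sup: "\<And>i. i \<in> I \<Longrightarrow> x i \<noteq> \<one>\<^bsub>\<Omega> i\<^esub> \<Longrightarrow> \<exists>h\<in>H. h i \<noteq> \<one>\<^bsub>\<Omega> i\<^esub>"
  shows "x \<in> H"
  using fin x sup
proof (induction "{i \<in> I. x i \<noteq> \<one>\<^bsub>\<Omega> i\<^esub>}" arbitrary: x rule: finite_psubset_induct)
  case psubset
  show ?case
  proof (cases "{i \<in> I. x i \<noteq> \<one>\<^bsub>\<Omega> i\<^esub>} = {}")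
    case True
    then have "x = \<one>\<^bsub>product_group I \<Omega>\<^esub>"
      using psubset.prems(1) by (auto simp: PiE_iff extensional_def fun_eq_iff)
    then show ?thesis using subgroup.one_closed[OF H(1)] by simp
  next
    case False
    then obtain i where i: "i \<in> I" "x i \<noteq> \<one>\<^bsub>\<Omega> i\<^esub>" by blast
    define y where "y = (\<lambda>j\<in>I. if j = i then \<one>\<^bsub>\<Omega> j\<^esub> else x j)"
    have xi: "x i \<in> carrier (\<Omega> i)" using i psubset.prems(1) by auto
    have "y \<in> H"
    proof (rule psubset.hyps(2))
      show "{i \<in> I. y i \<noteq> \<one>\<^bsub>\<Omega> i\<^esub>} \<subset> {i \<in> I. x i \<noteq> \<one>\<^bsub>\<Omega> i\<^esub>}"
        using i by (auto simp: y_def)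
      show "y \<in> (\<Pi>\<^sub>E i\<in>I. carrier (\<Omega> i))"
        using psubset.prems(1) by (auto simp: y_def grp group.is_monoid PiE_iff)
      show "\<exists>h\<in>H. h j \<noteq> \<one>\<^bsub>\<Omega> j\<^esub>" if "j \<in> I" "y j \<noteq> \<one>\<^bsub>\<Omega> j\<^esub>" for j
        using psubset.prems(2)[of j] that by (simp add: y_def split: if_splits)
    qed
    moreover have "factor_embed I \<Omega> i (x i) \<in> H"
      using psubset.prems(2)[OF i] H(2) i xi by (auto simp: factor_closed_def)
    ultimately have "factor_embed I \<Omega> i (x i) \<otimes>\<^bsub>product_group I \<Omega>\<^esub> y \<in> H"
      using subgroup.m_closed[OF H(1)] by blast
    moreover have "factor_embed I \<Omega> i (x i) \<otimes>\<^bsub>product_group I \<Omega>\<^esub> y = x"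
      using psubset.prems(1) i xi
      by (auto simp: factor_embed_def y_def PiE_iff extensional_def fun_eq_iff grp group.is_monoid)
    ultimately show ?thesis by simp
  qed
qed

text \<open>If \<open>x \<in> H\<close> is nontrivial at \<open>i\<close>, then \<open>K\<close> contains the factor \<open>\<Omega> i\<close>, so this factor
  normalises \<open>H\<close> and meets it in a normal subgroup \<open>M\<close>. That \<open>M\<close> is not trivial is seen by
  commuting \<open>x\<close> with some \<open>\<omega>\<close> in the factor: the commutator is concentrated at \<open>i\<close>, and \<open>\<omega>\<close> can be
  chosen not to commute with \<open>x i\<close>. As \<open>\<Omega> i\<close> is simple, \<open>M\<close> is all of it.\<close>

lemma factor_closed_normal:
  assumes simple: "\<And>i. i \<in> I \<Longrightarrow> simple_grp (\<Omega> i)"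
    and nonab: "\<And>i. i \<in> I \<Longrightarrow> \<not> comm_group (\<Omega> i)"
    and K: "subgroup K (product_group I \<Omega>)" "factor_closed I \<Omega> K"
    and H: "H \<lhd> (product_group I \<Omega>)\<lparr>carrier := K\<rparr>"
  shows "factor_closed I \<Omega> H"
  unfolding factor_closed_def
proof (intro ballI impI)
  fix x i assume x: "x \<in> H" and i: "i \<in> I" and xi: "x i \<noteq> \<one>\<^bsub>\<Omega> i\<^esub>"
  let ?P = "product_group I \<Omega>" and ?e = "factor_embed I \<Omega> i"
  have grp: "group (\<Omega> j)" if "j \<in> I" for j
    using simple[OF that] by (simp add: simple_grp_def)
  interpret e: group_hom "\<Omega> i" ?P ?e
    using grp i by (rule factor_embed_hom)
  have HK: "H \<subseteq> K" using normal_imp_subgroup[OF H] subgroup.subset by force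
  have subH: "subgroup H ?P"
    using e.H.incl_subgroup[OF K(1) normal_imp_subgroup[OF H]] .
  have xP: "x \<in> (\<Pi>\<^sub>E i\<in>I. carrier (\<Omega> i))"
    using x subgroup.subset[OF subH] by auto
  then have xic: "x i \<in> carrier (\<Omega> i)" using i by auto
  have eK: "?e ` carrier (\<Omega> i) \<subseteq> K"
    using K(2) x HK i xi by (auto simp: factor_closed_def)
  have conj: "k \<otimes>\<^bsub>?P\<^esub> h \<otimes>\<^bsub>?P\<^esub> inv\<^bsub>?P\<^esub> k \<in> H" if "k \<in> K" "h \<in> H" for k h
    using normal_conj_closed[OF e.H.is_group K(1) H that] .
  define M where "M = {\<omega> \<in> carrier (\<Omega> i). ?e \<omega> \<in> H}"
  have "M \<lhd> \<Omega> i"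
  proof (rule e.G.normal_invI)
    show "subgroup M (\<Omega> i)"
      by (rule e.G.subgroupI)
        (use subH in \<open>auto simp: M_def subgroup.m_inv_closed subgroup.m_closed subgroup.one_closed
          simp del: mult_product_group inv_product_group one_product_group
          intro!: exI[of _ "\<one>\<^bsub>\<Omega> i\<^esub>"]\<close>)
    show "\<eta> \<otimes>\<^bsub>\<Omega> i\<^esub> \<omega> \<otimes>\<^bsub>\<Omega> i\<^esub> inv\<^bsub>\<Omega> i\<^esub> \<eta> \<in> M" if "\<eta> \<in> carrier (\<Omega> i)" "\<omega> \<in> M" for \<eta> \<omega>
      using that conj[of "?e \<eta>" "?e \<omega>"] eK
      by (auto simp: M_def simp del: mult_product_group inv_product_group)
  qed
  moreover have "\<exists>\<omega>\<in>M. \<omega> \<noteq> \<one>\<^bsub>\<Omega> i\<^esub>"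
  proof -
    obtain \<omega> where \<omega>: "\<omega> \<in> carrier (\<Omega> i)" "x i \<otimes>\<^bsub>\<Omega> i\<^esub> \<omega> \<noteq> \<omega> \<otimes>\<^bsub>\<Omega> i\<^esub> x i"
      using simple_nonabelian_noncommuting[OF simple[OF i] nonab[OF i] xic xi] .
    let ?c = "\<omega> \<otimes>\<^bsub>\<Omega> i\<^esub> x i \<otimes>\<^bsub>\<Omega> i\<^esub> inv\<^bsub>\<Omega> i\<^esub> \<omega> \<otimes>\<^bsub>\<Omega> i\<^esub> inv\<^bsub>\<Omega> i\<^esub> x i"
    have "?e \<omega> \<otimes>\<^bsub>?P\<^esub> x \<otimes>\<^bsub>?P\<^esub> inv\<^bsub>?P\<^esub> (?e \<omega>) \<otimes>\<^bsub>?P\<^esub> inv\<^bsub>?P\<^esub> x = ?e ?c"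
      using e.hom_closed[OF \<omega>(1)] xP \<omega>(1)
      by (auto simp: fun_eq_iff factor_embed_def grp group.is_monoid monoid.inv_one group.r_inv
          PiE_iff)
    moreover have "?e \<omega> \<otimes>\<^bsub>?P\<^esub> x \<otimes>\<^bsub>?P\<^esub> inv\<^bsub>?P\<^esub> (?e \<omega>) \<otimes>\<^bsub>?P\<^esub> inv\<^bsub>?P\<^esub> x \<in> H"
      using conj[of "?e \<omega>" x] eK \<omega>(1) x subH
      by (blast intro: subgroup.m_closed subgroup.m_inv_closed)
    ultimately have "?c \<in> M" using \<omega>(1) xic by (simp add: M_def)
    moreover have "?c \<noteq> \<one>\<^bsub>\<Omega> i\<^esub>"
    proof
      assume "?c = \<one>\<^bsub>\<Omega> i\<^esub>"
      then have "\<omega> \<otimes>\<^bsub>\<Omega> i\<^esub> x i \<otimes>\<^bsub>\<Omega> i\<^esub> inv\<^bsub>\<Omega> i\<^esub> \<omega> = x i"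
        using \<omega>(1) xic e.G.inv_equality[of "\<omega> \<otimes>\<^bsub>\<Omega> i\<^esub> x i \<otimes>\<^bsub>\<Omega> i\<^esub> inv\<^bsub>\<Omega> i\<^esub> \<omega>" "inv\<^bsub>\<Omega> i\<^esub> x i"]
        by simp
      then show False
        using \<omega> xic e.G.inv_solve_right[of "x i" "\<omega> \<otimes>\<^bsub>\<Omega> i\<^esub> x i" \<omega>] by simp
    qed
    ultimately show ?thesis by blast
  qed
  ultimately have "M = carrier (\<Omega> i)"
    using simple[OF i] by (auto simp: simple_grp_def)
  then show "?e ` carrier (\<Omega> i) \<subseteq> H" by (auto simp: M_def)
qed

lemma subnormal_factor_closed:
  assumes simple: "\<And>i. i \<in> I \<Longrightarrow> simple_grp (\<Omega> i)"
    and nonab: "\<And>i. i \<in> I \<Longrightarrow> \<not> comm_group (\<Omega> i)"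
    and A: "subgroup A (product_group I \<Omega>)" "carrier (sum_group I \<Omega>) \<subseteq> A"
    and H: "subnormal ((product_group I \<Omega>)\<lparr>carrier := A\<rparr>) H"
  shows "factor_closed I \<Omega> H"
proof -
  let ?P = "product_group I \<Omega>"
  have grp: "group (\<Omega> j)" if "j \<in> I" for j
    using simple[OF that] by (simp add: simple_grp_def)
  then have P: "group ?P" by simp
  have A': "group (?P\<lparr>carrier := A\<rparr>)"
    using group.subgroup_imp_group[OF P A(1)] .
  show ?thesis
    using H
  proof induction
    case whole
    have "factor_embed I \<Omega> i \<omega> \<in> carrier (sum_group I \<Omega>)" if "i \<in> I" "\<omega> \<in> carrier (\<Omega> i)" for i \<omega>
    proof -
      have "finite {j \<in> I. factor_embed I \<Omega> i \<omega> j \<noteq> \<one>\<^bsub>\<Omega> j\<^esub>}"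
        by (rule finite_subset[of _ "{i}"]) (auto simp: factor_embed_def)
      then show ?thesis
        using that by (auto simp: carrier_sum_group grp factor_embed_def group.is_monoid)
    qed
    with A(2) show ?case by (auto simp: factor_closed_def)
  next
    case (step K H)
    have "subgroup K ?P"
      using subnormal_imp_subgroup[OF A' step.hyps(1)] group.incl_subgroup[OF P A(1)] by blast
    then show ?case
      using factor_closed_normal[OF simple nonab _ step.IH] step.hyps(2) by simp
  qed
qed

text \<open>The dichotomy of \<open>subnormal_image_simple\<close>, applied to the projection onto the simple quotient,
  leaves two cases. If \<open>H\<close> lies in the direct sum, a conjugate of \<open>h \<in> H\<close> has finite support on
  which \<open>h\<close> is nontrivial. If \<open>H\<close> maps onto the quotient, every element is a product \<open>n k\<close> with \<open>n\<close>
  in the direct sum and \<open>k \<in> H\<close>, and conjugating \<open>c \<in> H\<close> by \<open>n\<close> changes \<open>c\<close> by a commutator that has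
  finite support on which \<open>c\<close> is nontrivial.\<close>

theorem t_group_extending_direct_sum:
  assumes simple: "\<And>i. i \<in> I \<Longrightarrow> simple_grp (\<Omega> i)"
    and nonab: "\<And>i. i \<in> I \<Longrightarrow> \<not> comm_group (\<Omega> i)"
    and A: "subgroup A (product_group I \<Omega>)" "carrier (sum_group I \<Omega>) \<subseteq> A"
    and head: "simple_grp ((product_group I \<Omega>)\<lparr>carrier := A\<rparr> Mod carrier (sum_group I \<Omega>))"
  shows "t_group ((product_group I \<Omega>)\<lparr>carrier := A\<rparr>)"
proof -
  let ?P = "product_group I \<Omega>" and ?N = "carrier (sum_group I \<Omega>)"
  let ?A = "?P\<lparr>carrier := A\<rparr>"
  have grp: "group (\<Omega> j)" if "j \<in> I" for j
    using simple[OF that] by (simp add: simple_grp_def)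
  interpret P: group ?P using grp by simp
  interpret A: group ?A by (rule P.subgroup_imp_group[OF A(1)])
  have AP: "A \<subseteq> carrier ?P" using A(1) by (rule subgroup.subset)
  have N: "subgroup ?N ?P"
    using grp subgroup_sum_group[of I \<Omega>] by (simp add: carrier_sum_group)
  have conj_fin: "g \<otimes>\<^bsub>?P\<^esub> h \<otimes>\<^bsub>?P\<^esub> inv\<^bsub>?P\<^esub> g \<in> ?N"
    if "g \<in> carrier ?P" "h \<in> ?N" for g h
  proof -
    have h: "h \<in> carrier ?P" using that(2) N subgroup.subset by blast
    have "{i \<in> I. (g \<otimes>\<^bsub>?P\<^esub> h \<otimes>\<^bsub>?P\<^esub> inv\<^bsub>?P\<^esub> g) i \<noteq> \<one>\<^bsub>\<Omega> i\<^esub>} \<subseteq> {i \<in> I. h i \<noteq> \<one>\<^bsub>\<Omega> i\<^esub>}"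
      using that(1) h by (auto simp: grp PiE_iff group.is_monoid group.r_inv)
    moreover have "g \<otimes>\<^bsub>?P\<^esub> h \<otimes>\<^bsub>?P\<^esub> inv\<^bsub>?P\<^esub> g \<in> carrier ?P"
      using that(1) h by (intro P.m_closed P.inv_closed)
    moreover have "finite {i \<in> I. h i \<noteq> \<one>\<^bsub>\<Omega> i\<^esub>}"
      using that(2) carrier_sum_group[of I \<Omega>] grp by simp
    ultimately show ?thesis
      using carrier_sum_group[of I \<Omega>] grp finite_subset
      by (simp del: mult_product_group inv_product_group) blast
  qed
  have NA: "?N \<lhd> ?A"
  proof (rule A.normal_invI)
    show "subgroup ?N ?A" using P.subgroup_incl[OF N A] .
    show "g \<otimes>\<^bsub>?A\<^esub> h \<otimes>\<^bsub>?A\<^esub> inv\<^bsub>?A\<^esub> g \<in> ?N" if "g \<in> carrier ?A" "h \<in> ?N" for g h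
      using conj_fin[of g h] that AP P.m_inv_consistent[OF A(1), of g] by auto
  qed
  interpret N: normal ?N ?A by (rule NA)
  let ?q = "\<lambda>a. ?N #>\<^bsub>?A\<^esub> a"
  have q: "group_hom ?A (?A Mod ?N) ?q"
    using N.factorgroup_is_group N.r_coset_hom_Mod A.is_group
    by (simp add: group_hom_def group_hom_axioms_def)
  have "H \<lhd> ?A" if sub: "subnormal ?A H" for H
  proof (rule A.normal_invI)
    show HA: "subgroup H ?A"
      using A.is_group sub by (rule subnormal_imp_subgroup)
    have H: "subgroup H ?P" using P.incl_subgroup[OF A(1) HA] .
    have HsubA: "H \<subseteq> A" using subgroup.subset[OF HA] by simp
    have fc: "factor_closed I \<Omega> H"
      using subnormal_factor_closed[OF simple nonab A sub] .
    have cases: "?q ` H = {?N} \<or> ?q ` H = carrier (?A Mod ?N)"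
      using subnormal_image_simple[OF q _ head sub] by (simp add: carrier_FactGroup)
    fix g h assume "g \<in> carrier ?A" and h: "h \<in> H"
    then have g: "g \<in> A" by simp
    have gP: "g \<in> carrier ?P" and hP: "h \<in> carrier ?P" using g h AP HsubA by auto
    have "g \<otimes>\<^bsub>?P\<^esub> h \<otimes>\<^bsub>?P\<^esub> inv\<^bsub>?P\<^esub> g \<in> H"
      using cases
    proof
      assume "?q ` H = {?N}"
      then have "h \<in> ?N" using h HsubA A.rcos_self[OF _ N.subgroup_axioms, of h] by auto
      from conj_fin[OF gP this] show ?thesis
      proof (intro finite_support_mem[OF grp H fc])
        fix i assume "i \<in> I" "(g \<otimes>\<^bsub>?P\<^esub> h \<otimes>\<^bsub>?P\<^esub> inv\<^bsub>?P\<^esub> g) i \<noteq> \<one>\<^bsub>\<Omega> i\<^esub>"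
        then have "h i \<noteq> \<one>\<^bsub>\<Omega> i\<^esub>"
          using gP hP by (auto simp: grp PiE_iff group.is_monoid group.r_inv)
        with h show "\<exists>h\<in>H. h i \<noteq> \<one>\<^bsub>\<Omega> i\<^esub>" by blast
      qed (auto simp: carrier_sum_group grp)
    next
      assume "?q ` H = carrier (?A Mod ?N)"
      then have "?q g \<in> ?q ` H" using g by (simp add: carrier_FactGroup)
      then obtain k where k: "k \<in> H" "?q g = ?q k" by blast
      then have "g \<in> ?q k" using A.rcos_self[OF _ N.subgroup_axioms, of g] g by simp
      then obtain n where n: "n \<in> ?N" "g = n \<otimes>\<^bsub>?P\<^esub> k"
        by (auto simp: r_coset_def)
      have kP: "k \<in> carrier ?P" and nP: "n \<in> carrier ?P"
        using k(1) n(1) AP HsubA N subgroup.subset by blast+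
      define c where "c = k \<otimes>\<^bsub>?P\<^esub> h \<otimes>\<^bsub>?P\<^esub> inv\<^bsub>?P\<^esub> k"
      have cH: "c \<in> H"
        using k(1) h H by (auto simp: c_def intro: subgroup.m_closed subgroup.m_inv_closed
            simp del: mult_product_group inv_product_group)
      have cP: "c \<in> carrier ?P" using cH HsubA AP by blast
      have "n \<otimes>\<^bsub>?P\<^esub> (c \<otimes>\<^bsub>?P\<^esub> inv\<^bsub>?P\<^esub> n \<otimes>\<^bsub>?P\<^esub> inv\<^bsub>?P\<^esub> c) \<in> H" (is "?w \<in> H")
      proof (rule finite_support_mem[OF grp H fc])
        have "c \<otimes>\<^bsub>?P\<^esub> inv\<^bsub>?P\<^esub> n \<otimes>\<^bsub>?P\<^esub> inv\<^bsub>?P\<^esub> c \<in> ?N"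
          using conj_fin[OF cP subgroup.m_inv_closed[OF N n(1)]] .
        then have "?w \<in> ?N" using subgroup.m_closed[OF N n(1)] by blast
        then show "?w \<in> (\<Pi>\<^sub>E i\<in>I. carrier (\<Omega> i))" "finite {i \<in> I. ?w i \<noteq> \<one>\<^bsub>\<Omega> i\<^esub>}"
          using carrier_sum_group[of I \<Omega>] grp by auto
        fix i assume "i \<in> I" "?w i \<noteq> \<one>\<^bsub>\<Omega> i\<^esub>"
        then have "c i \<noteq> \<one>\<^bsub>\<Omega> i\<^esub>"
          using nP cP by (auto simp: grp PiE_iff group.is_monoid group.r_inv monoid.inv_one)
        with cH show "\<exists>h\<in>H. h i \<noteq> \<one>\<^bsub>\<Omega> i\<^esub>" by blast
      qed
      then have "?w \<otimes>\<^bsub>?P\<^esub> c \<in> H" using cH subgroup.m_closed[OF H] by blast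
      moreover have "?w \<otimes>\<^bsub>?P\<^esub> c = n \<otimes>\<^bsub>?P\<^esub> c \<otimes>\<^bsub>?P\<^esub> inv\<^bsub>?P\<^esub> n"
        using nP cP by (simp add: P.m_assoc
            del: mult_product_group inv_product_group carrier_product_group one_product_group)
      moreover have "\<dots> = g \<otimes>\<^bsub>?P\<^esub> h \<otimes>\<^bsub>?P\<^esub> inv\<^bsub>?P\<^esub> g"
        using kP nP hP unfolding n(2) c_def
        by (simp add: P.m_assoc P.inv_mult_group
            del: mult_product_group inv_product_group carrier_product_group one_product_group)
      ultimately show ?thesis by (simp only:)
    qed
    then show "g \<otimes>\<^bsub>?A\<^esub> h \<otimes>\<^bsub>?A\<^esub> inv\<^bsub>?A\<^esub> g \<in> H"
      using P.m_inv_consistent[OF A(1) g]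
      by (simp del: mult_product_group inv_product_group)
  qed
  then show ?thesis by (simp add: t_group_def A.is_group)
qed

section \<open>Commutation lemmas\<close>

lemma commute_if_trivial_commutator_subgroup:
  assumes "group G" "commutator_subgroup G X Y = {\<one>\<^bsub>G\<^esub>}"
    "x \<in> X" "y \<in> Y" "x \<in> carrier G" "y \<in> carrier G"
  shows "x \<otimes>\<^bsub>G\<^esub> y = y \<otimes>\<^bsub>G\<^esub> x"
proof -
  interpret group G by (rule assms(1))
  have "commutator G x y \<in> commutator_subgroup G X Y"
    using assms(3,4) by (auto simp: commutator_subgroup_def intro!: generate.incl)
  then have "x \<otimes>\<^bsub>G\<^esub> y \<otimes>\<^bsub>G\<^esub> inv\<^bsub>G\<^esub> (y \<otimes>\<^bsub>G\<^esub> x) = \<one>\<^bsub>G\<^esub>"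
    using assms by (simp add: commutator_def inv_mult_group m_assoc)
  then show ?thesis
    using assms(5,6) inv_solve_right[of "\<one>\<^bsub>G\<^esub>" "x \<otimes>\<^bsub>G\<^esub> y" "y \<otimes>\<^bsub>G\<^esub> x"] by simp
qed

context group
begin

lemma foldr_mult_closed:
  "(\<And>k. k \<in> set ks \<Longrightarrow> f k \<in> carrier G) \<Longrightarrow> foldr (\<lambda>k y. f k \<otimes> y) ks \<one> \<in> carrier G"
  by (induction ks) auto

lemma foldr_mult_commute:
  assumes "\<And>k. k \<in> set ks \<Longrightarrow> f k \<in> carrier G" "x \<in> carrier G"
    and "\<And>k. k \<in> set ks \<Longrightarrow> f k \<otimes> x = x \<otimes> f k"
  shows "foldr (\<lambda>k y. f k \<otimes> y) ks \<one> \<otimes> x = x \<otimes> foldr (\<lambda>k y. f k \<otimes> y) ks \<one>"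
  using assms
proof (induction ks)
  case (Cons k ks)
  let ?p = "foldr (\<lambda>k y. f k \<otimes> y) ks \<one>"
  have p: "?p \<in> carrier G" using Cons.prems(1) by (intro foldr_mult_closed) auto
  have "f k \<otimes> ?p \<otimes> x = f k \<otimes> (x \<otimes> ?p)"
    using Cons p by (simp add: m_assoc)
  also have "\<dots> = x \<otimes> (f k \<otimes> ?p)"
    using Cons.prems(1,2) Cons.prems(3)[of k] p by (simp flip: m_assoc)
  finally show ?case by simp
qed simp

lemma conj_foldr_mult:
  assumes "\<And>k. k \<in> set ks \<Longrightarrow> f k \<in> carrier G" "a \<in> carrier G"
  shows "inv a \<otimes> foldr (\<lambda>k y. f k \<otimes> y) ks \<one> \<otimes> a =
         foldr (\<lambda>k y. (inv a \<otimes> f k \<otimes> a) \<otimes> y) ks \<one>"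
  using assms
proof (induction ks)
  case (Cons k ks)
  let ?p = "foldr (\<lambda>k y. f k \<otimes> y) ks \<one>"
  have p: "?p \<in> carrier G" using Cons.prems(1) by (intro foldr_mult_closed) auto
  have cancel: "a \<otimes> (inv a \<otimes> y) = y" if "y \<in> carrier G" for y
    using that Cons.prems(2) by (simp flip: m_assoc)
  have "inv a \<otimes> (f k \<otimes> ?p) \<otimes> a = (inv a \<otimes> f k \<otimes> a) \<otimes> (inv a \<otimes> ?p \<otimes> a)"
    using Cons.prems p by (simp add: m_assoc cancel)
  then show ?case using Cons by simp
qed simp

text \<open>This is the situation in one coordinate of the telescope: \<open>b\<close> and \<open>c\<close> are the leading factors
  of two tails, \<open>p\<close> and \<open>r\<close> the remaining products, and \<open>a\<close> the flexing element. Conjugation by \<open>a\<close>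
  keeps \<open>b\<close> and moves \<open>p\<close> to an element that commutes with both \<open>c\<close> and \<open>r\<close>, so only \<open>b\<close> and \<open>c\<close>
  contribute to the commutator.\<close>

lemma commutator_absorb:
  assumes carr: "a \<in> carrier G" "b \<in> carrier G" "c \<in> carrier G" "p \<in> carrier G" "r \<in> carrier G"
    and ab: "a \<otimes> b = b \<otimes> a" and ac: "a \<otimes> c = c \<otimes> a"
    and pc: "p \<otimes> c = c \<otimes> p" and rb: "r \<otimes> b = b \<otimes> r"
    and pr: "(inv a \<otimes> p \<otimes> a) \<otimes> r = r \<otimes> (inv a \<otimes> p \<otimes> a)"
  shows "commutator G (inv a \<otimes> (b \<otimes> p) \<otimes> a) (c \<otimes> r) = commutator G b c"
proof -
  define q where "q = inv a \<otimes> p \<otimes> a"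
  have q: "q \<in> carrier G" using carr by (simp add: q_def)
  have ab': "inv a \<otimes> b = b \<otimes> inv a"
    using ab carr by (intro inv_commute)
  have ac': "inv a \<otimes> c = c \<otimes> inv a"
    using ac carr by (intro inv_commute)
  have bq: "inv a \<otimes> (b \<otimes> p) \<otimes> a = b \<otimes> q"
    using carr ab' by (simp add: q_def flip: m_assoc)
  have "q \<otimes> c = inv a \<otimes> (p \<otimes> c) \<otimes> a"
    using carr ac by (simp add: q_def m_assoc)
  also have "\<dots> = (inv a \<otimes> c) \<otimes> p \<otimes> a"
    unfolding pc using carr by (simp add: m_assoc)
  also have "\<dots> = c \<otimes> q"
    unfolding ac' using carr by (simp add: q_def m_assoc)
  finally have qc: "q \<otimes> c = c \<otimes> q" .
  have "b \<otimes> q \<otimes> (c \<otimes> r) = b \<otimes> (q \<otimes> c) \<otimes> r"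
    using carr q by (simp add: m_assoc)
  also have "\<dots> = b \<otimes> c \<otimes> (q \<otimes> r)"
    using carr q qc by (simp add: m_assoc)
  also have "\<dots> = b \<otimes> c \<otimes> (r \<otimes> q)"
    using pr by (simp add: q_def)
  finally have 1: "b \<otimes> q \<otimes> (c \<otimes> r) = b \<otimes> c \<otimes> r \<otimes> q"
    using carr q by (simp add: m_assoc)
  have "inv b \<otimes> inv r = inv r \<otimes> inv b"
    using rb carr by (metis inv_mult_group)
  then have "r \<otimes> inv b \<otimes> inv r = r \<otimes> (inv r \<otimes> inv b)"
    using carr by (simp add: m_assoc)
  also have "\<dots> = inv b"
    using carr by (simp flip: m_assoc)
  finally have 2: "r \<otimes> inv b \<otimes> inv r = inv b" .
  have cancel: "q \<otimes> (inv q \<otimes> y) = y" if "y \<in> carrier G" for y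
    using that q by (simp flip: m_assoc)
  have "commutator G (b \<otimes> q) (c \<otimes> r) = b \<otimes> c \<otimes> (r \<otimes> inv b \<otimes> inv r) \<otimes> inv c"
    unfolding commutator_def 1 using carr q by (simp add: inv_mult_group m_assoc cancel)
  then show ?thesis
    using carr by (simp add: bq 2 commutator_def)
qed

end

section \<open>Diagonal elements and tails in a telescope\<close>

text \<open>The case \<open>i = 1\<close> is \<open>tel_tilde\<close>. Dropping the factors with index at most \<open>i\<close> makes the
  coordinates up to \<open>i\<close> trivial, so that an induction on \<open>i\<close> can work further and further out.\<close>

definition tel_tail ::
  "(nat \<Rightarrow> ('a, 'm) monoid_scheme) \<Rightarrow> (nat \<Rightarrow> nat \<Rightarrow> 'a \<Rightarrow> 'a) \<Rightarrow> (nat \<Rightarrow> 'b \<Rightarrow> 'a) \<Rightarrow>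
   nat \<Rightarrow> 'b \<Rightarrow> nat \<Rightarrow> 'a" where
  "tel_tail \<Omega> \<iota> \<phi> i g =
     (\<lambda>m\<in>{1..}. foldr (\<lambda>k y. \<iota> k m (\<phi> k g) \<otimes>\<^bsub>\<Omega> m\<^esub> y) [Suc i..<Suc m] \<one>\<^bsub>\<Omega> m\<^esub>)"

lemma tel_tilde_eq_tail: "tel_tilde \<Omega> \<iota> \<phi> g = tel_tail \<Omega> \<iota> \<phi> 1 g"
  by (simp add: tel_tilde_def tel_tail_def numeral_2_eq_2)

context telescope
begin

abbreviation P where "P \<equiv> tel_product \<Omega>"
abbreviation diag where "diag \<equiv> tel_diag \<Omega> \<iota>"
abbreviation tail where "tail \<equiv> tel_tail \<Omega> \<iota> \<phi>"

lemma group_P: "group P"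
  by (rule product_group) (simp add: group_Omega)

lemma inv_P_apply: "\<lbrakk>x \<in> carrier P; 1 \<le> m\<rbrakk> \<Longrightarrow> (inv\<^bsub>P\<^esub> x) m = inv\<^bsub>\<Omega> m\<^esub> x m"
  by (subst inv_product_group) (auto simp: group_Omega)

lemma commutator_P_apply:
  "\<lbrakk>x \<in> carrier P; y \<in> carrier P; 1 \<le> m\<rbrakk> \<Longrightarrow>
    commutator P x y m = commutator (\<Omega> m) (x m) (y m)"
  by (simp add: commutator_def inv_P_apply
      del: One_nat_def inv_product_group carrier_product_group)

lemma iota_group_hom:
  assumes "1 \<le> i" "i \<le> j"
  shows "group_hom (\<Omega> i) (\<Omega> j) (\<iota> i j)"
proof (cases "i = j")
  case True
  then show ?thesis
    using assms group_Omega[OF assms(1)] iota_id[OF assms(1)]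
    by (auto simp: group_hom_def group_hom_axioms_def hom_def group.is_monoid monoid.m_closed)
next
  case False
  then show ?thesis
    using assms iota_hom[of i j] group_Omega by (simp add: group_hom_def group_hom_axioms_def)
qed

lemma iota_iota:
  assumes "1 \<le> i" "i \<le> j" "j \<le> k" "x \<in> carrier (\<Omega> i)"
  shows "\<iota> j k (\<iota> i j x) = \<iota> i k x"
proof -
  have "\<iota> i j x \<in> carrier (\<Omega> j)"
    using group_hom.hom_closed[OF iota_group_hom] assms by blast
  then show ?thesis
    using assms iota_id iota_comp by (cases "i = j"; cases "j = k") auto
qed

lemma iota_closed: "\<lbrakk>1 \<le> i; i \<le> j; x \<in> carrier (\<Omega> i)\<rbrakk> \<Longrightarrow> \<iota> i j x \<in> carrier (\<Omega> j)"
  using group_hom.hom_closed[OF iota_group_hom] .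

lemma phi_group_hom: "2 \<le> i \<Longrightarrow> group_hom B (\<Omega> i) (\<phi> i)"
  using phi_hom group_B group_Omega by (simp add: group_hom_def group_hom_axioms_def)

lemma phi_closed: "\<lbrakk>2 \<le> i; g \<in> carrier B\<rbrakk> \<Longrightarrow> \<phi> i g \<in> carrier (\<Omega> i)"
  using group_hom.hom_closed[OF phi_group_hom] .

lemma iota_phi_closed:
  "\<lbrakk>2 \<le> k; k \<le> m; g \<in> carrier B\<rbrakk> \<Longrightarrow> \<iota> k m (\<phi> k g) \<in> carrier (\<Omega> m)"
  by (simp add: iota_closed phi_closed)

lemma diag_group_hom:
  assumes "1 \<le> i"
  shows "group_hom (\<Omega> i) P (diag i)"
proof -
  have "diag i x \<in> carrier P" if "x \<in> carrier (\<Omega> i)" for x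
    using assms that by (auto simp: tel_diag_def iota_closed group_Omega group.is_monoid)
  moreover have "diag i (x \<otimes>\<^bsub>\<Omega> i\<^esub> y) = diag i x \<otimes>\<^bsub>P\<^esub> diag i y"
    if "x \<in> carrier (\<Omega> i)" "y \<in> carrier (\<Omega> i)" for x y
    using assms that group_hom.hom_mult[OF iota_group_hom]
    by (auto simp: tel_diag_def fun_eq_iff group_Omega group.is_monoid)
  ultimately show ?thesis
    using group_Omega group_P assms
    by (simp add: group_hom_def group_hom_axioms_def hom_def del: One_nat_def)
qed

text \<open>In the axiom \<open>images_commute\<close> one of the two images has the index of the ambient group. The
  general case follows by applying \<open>\<iota> l m\<close>.\<close>

lemma images_commute_less:
  assumes "2 \<le> k" "k < l" "l \<le> m" "g \<in> carrier B" "h \<in> carrier B"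
  shows "\<iota> k m (\<phi> k g) \<otimes>\<^bsub>\<Omega> m\<^esub> \<iota> l m (\<phi> l h) = \<iota> l m (\<phi> l h) \<otimes>\<^bsub>\<Omega> m\<^esub> \<iota> k m (\<phi> k g)"
proof -
  interpret lm: group_hom "\<Omega> l" "\<Omega> m" "\<iota> l m"
    using assms by (intro iota_group_hom) auto
  have *: "\<phi> k g \<in> carrier (\<Omega> k)" "\<iota> k l (\<phi> k g) \<in> carrier (\<Omega> l)" "\<phi> l h \<in> carrier (\<Omega> l)"
    using assms by (simp_all add: iota_phi_closed phi_closed)
  have "\<iota> k l (\<phi> k g) \<otimes>\<^bsub>\<Omega> l\<^esub> \<phi> l h = \<phi> l h \<otimes>\<^bsub>\<Omega> l\<^esub> \<iota> k l (\<phi> k g)"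
    using assms * commute_if_trivial_commutator_subgroup[OF lm.G.is_group images_commute]
    by (auto simp: tel_image_def)
  then have "\<iota> l m (\<iota> k l (\<phi> k g) \<otimes>\<^bsub>\<Omega> l\<^esub> \<phi> l h) = \<iota> l m (\<phi> l h \<otimes>\<^bsub>\<Omega> l\<^esub> \<iota> k l (\<phi> k g))"
    by simp
  then show ?thesis
    using assms * by (simp add: iota_iota)
qed

lemma images_commute':
  assumes "2 \<le> k" "2 \<le> l" "k \<noteq> l" "k \<le> m" "l \<le> m" "g \<in> carrier B" "h \<in> carrier B"
  shows "\<iota> k m (\<phi> k g) \<otimes>\<^bsub>\<Omega> m\<^esub> \<iota> l m (\<phi> l h) = \<iota> l m (\<phi> l h) \<otimes>\<^bsub>\<Omega> m\<^esub> \<iota> k m (\<phi> k g)"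
  using assms images_commute_less[of k l m g h] images_commute_less[of l k m h g]
  by (cases "k < l") auto

lemma tail_closed:
  assumes "1 \<le> i" "g \<in> carrier B"
  shows "tail i g \<in> carrier P"
  using assms
  by (auto simp: tel_tail_def iota_phi_closed simp del: upt_Suc foldr.simps
      intro!: group.foldr_mult_closed group_Omega)

lemma tail_low: "\<lbrakk>1 \<le> m; m \<le> i\<rbrakk> \<Longrightarrow> tail i g m = \<one>\<^bsub>\<Omega> m\<^esub>"
  by (simp add: tel_tail_def)

lemma tail_split:
  assumes "1 \<le> i" "i < m"
  shows "tail i g m = \<iota> (Suc i) m (\<phi> (Suc i) g) \<otimes>\<^bsub>\<Omega> m\<^esub> tail (Suc i) g m"
  using assms by (simp add: tel_tail_def upt_conv_Cons del: upt_Suc)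

lemma tail_eq_diag_mult:
  assumes "1 \<le> i" "g \<in> carrier B"
  shows "tail i g = diag (Suc i) (\<phi> (Suc i) g) \<otimes>\<^bsub>P\<^esub> tail (Suc i) g"
proof
  fix m
  \<comment> \<open>Index \<open>0\<close> lies outside the index set of the product, where all elements are undefined.\<close>
  consider "m = 0" | "1 \<le> m" "m \<le> i" | "i < m" by linarith
  then show "tail i g m = (diag (Suc i) (\<phi> (Suc i) g) \<otimes>\<^bsub>P\<^esub> tail (Suc i) g) m"
  proof cases
    case 1
    then show ?thesis by (simp add: tel_tail_def)
  next
    case 2
    then show ?thesis by (simp add: tail_low tel_diag_def group_Omega group.is_monoid)
  next
    case 3
    then show ?thesis using assms by (simp add: tail_split tel_diag_def)
  qed
qed

text \<open>The identity is checked in each coordinate \<open>m\<close>. Up to \<open>m = i\<close> the tails are trivial. Beyond,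
  \<open>commutator_absorb\<close> applies: the leading factors commute with \<open>\<alpha>\<close> because (F1) is transported
  along \<open>\<iota> (Suc i) m\<close>, they commute with the later factors by the telescope axiom, and (F2) makes
  the conjugated later factors of one tail commute with the later factors of the other.\<close>

lemma tail_commutator:
  assumes i: "1 \<le> i" and \<alpha>: "\<alpha> \<in> carrier (\<Omega> i)"
    and F1: "commutator_subgroup (\<Omega> (i + 1)) {\<iota> i (i + 1) \<alpha>} (\<phi> (i + 1) ` carrier B)
               = {\<one>\<^bsub>\<Omega> (i + 1)\<^esub>}"
    and F2: "\<And>k l m. \<lbrakk>i + 2 \<le> k; i + 2 \<le> l; k \<le> m; l \<le> m\<rbrakk> \<Longrightarrow>
       commutator_subgroup (\<Omega> m) (conj_set (\<Omega> m) (tel_image B \<iota> \<phi> k m) (\<iota> i m \<alpha>))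
         (tel_image B \<iota> \<phi> l m) = {\<one>\<^bsub>\<Omega> m\<^esub>}"
    and g: "g \<in> carrier B" and h: "h \<in> carrier B"
  shows "commutator P (inv\<^bsub>P\<^esub> (diag i \<alpha>) \<otimes>\<^bsub>P\<^esub> tail i g \<otimes>\<^bsub>P\<^esub> diag i \<alpha>) (tail i h)
         = diag (Suc i) (\<phi> (Suc i) (commutator B g h))" (is "?lhs = ?rhs")
proof
  fix m
  note P = group_P
  have d: "diag i \<alpha> \<in> carrier P" using group_hom.hom_closed[OF diag_group_hom[OF i] \<alpha>] .
  note t = tail_closed[OF i g] tail_closed[OF i h]
  let ?x = "inv\<^bsub>P\<^esub> (diag i \<alpha>) \<otimes>\<^bsub>P\<^esub> tail i g \<otimes>\<^bsub>P\<^esub> diag i \<alpha>"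
  have x: "?x \<in> carrier P"
    using P d t by (meson group.inv_closed group.is_monoid monoid.m_closed)
  have lhs: "?lhs m = commutator (\<Omega> m) (inv\<^bsub>\<Omega> m\<^esub> (diag i \<alpha> m) \<otimes>\<^bsub>\<Omega> m\<^esub> tail i g m
      \<otimes>\<^bsub>\<Omega> m\<^esub> diag i \<alpha> m) (tail i h m)" if "1 \<le> m"
    using commutator_P_apply[OF x t(2) that] inv_P_apply[OF d that] that
    by (simp del: One_nat_def inv_product_group)
  consider "m = 0" | "1 \<le> m" "m \<le> i" | "i < m" by linarith
  then show "?lhs m = ?rhs m"
  proof cases
    case 1
    then show ?thesis by (simp add: commutator_def tel_diag_def)
  next
    case 2
    interpret group "\<Omega> m" by (rule group_Omega[OF 2(1)])
    have "diag i \<alpha> m \<in> carrier (\<Omega> m)" using d 2 by auto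
    then have "?lhs m = \<one>\<^bsub>\<Omega> m\<^esub>"
      unfolding lhs[OF 2(1)] tail_low[OF 2] by (simp add: commutator_def)
    then show ?thesis
      using 2 by (simp add: tel_diag_def)
  next
    case 3
    then have m: "1 \<le> m" by simp
    interpret group "\<Omega> m" by (rule group_Omega[OF m])
    interpret sm: group_hom "\<Omega> (Suc i)" "\<Omega> m" "\<iota> (Suc i) m"
      using 3 by (intro iota_group_hom) auto
    interpret phi: group_hom B "\<Omega> (Suc i)" "\<phi> (Suc i)"
      using i by (intro phi_group_hom) auto
    let ?a = "\<iota> i m \<alpha>" and ?b = "\<iota> (Suc i) m (\<phi> (Suc i) g)" and ?c = "\<iota> (Suc i) m (\<phi> (Suc i) h)"
      and ?p = "tail (Suc i) g m" and ?r = "tail (Suc i) h m"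
    have a: "?a \<in> carrier (\<Omega> m)" using i 3 \<alpha> by (simp add: iota_closed)
    have bc: "?b \<in> carrier (\<Omega> m)" "?c \<in> carrier (\<Omega> m)" using g h by simp_all
    have pr: "?p \<in> carrier (\<Omega> m)" "?r \<in> carrier (\<Omega> m)"
      using tail_closed[of "Suc i" g] tail_closed[of "Suc i" h] g h m by auto
    have fixes_b: "?a \<otimes>\<^bsub>\<Omega> m\<^esub> \<iota> (Suc i) m (\<phi> (Suc i) f) = \<iota> (Suc i) m (\<phi> (Suc i) f) \<otimes>\<^bsub>\<Omega> m\<^esub> ?a"
      if f: "f \<in> carrier B" for f
    proof -
      have *: "\<iota> i (Suc i) \<alpha> \<in> carrier (\<Omega> (Suc i))" using i \<alpha> by (simp add: iota_closed)
      have "\<iota> i (Suc i) \<alpha> \<otimes>\<^bsub>\<Omega> (Suc i)\<^esub> \<phi> (Suc i) f = \<phi> (Suc i) f \<otimes>\<^bsub>\<Omega> (Suc i)\<^esub> \<iota> i (Suc i) \<alpha>"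
        using commute_if_trivial_commutator_subgroup[OF sm.G.is_group] F1 f * by simp
      then have "\<iota> (Suc i) m (\<iota> i (Suc i) \<alpha> \<otimes>\<^bsub>\<Omega> (Suc i)\<^esub> \<phi> (Suc i) f)
          = \<iota> (Suc i) m (\<phi> (Suc i) f \<otimes>\<^bsub>\<Omega> (Suc i)\<^esub> \<iota> i (Suc i) \<alpha>)" by simp
      then show ?thesis using i \<alpha> 3 f * by (simp add: iota_iota)
    qed
    have tail_comm: "tail (Suc i) f m \<otimes>\<^bsub>\<Omega> m\<^esub> \<iota> (Suc i) m (\<phi> (Suc i) f')
        = \<iota> (Suc i) m (\<phi> (Suc i) f') \<otimes>\<^bsub>\<Omega> m\<^esub> tail (Suc i) f m"
      if "f \<in> carrier B" "f' \<in> carrier B" for f f'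
      using that i 3 unfolding tel_tail_def
      by (auto simp del: upt_Suc intro!: foldr_mult_commute images_commute' iota_phi_closed)
    have "(inv\<^bsub>\<Omega> m\<^esub> ?a \<otimes>\<^bsub>\<Omega> m\<^esub> ?p \<otimes>\<^bsub>\<Omega> m\<^esub> ?a) \<otimes>\<^bsub>\<Omega> m\<^esub> ?r = ?r \<otimes>\<^bsub>\<Omega> m\<^esub> (inv\<^bsub>\<Omega> m\<^esub> ?a \<otimes>\<^bsub>\<Omega> m\<^esub> ?p \<otimes>\<^bsub>\<Omega> m\<^esub> ?a)"
    proof -
      have kl: "(inv\<^bsub>\<Omega> m\<^esub> ?a \<otimes>\<^bsub>\<Omega> m\<^esub> \<iota> k m (\<phi> k g) \<otimes>\<^bsub>\<Omega> m\<^esub> ?a) \<otimes>\<^bsub>\<Omega> m\<^esub> \<iota> l m (\<phi> l h)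
          = \<iota> l m (\<phi> l h) \<otimes>\<^bsub>\<Omega> m\<^esub> (inv\<^bsub>\<Omega> m\<^esub> ?a \<otimes>\<^bsub>\<Omega> m\<^esub> \<iota> k m (\<phi> k g) \<otimes>\<^bsub>\<Omega> m\<^esub> ?a)"
        if "i + 2 \<le> k" "i + 2 \<le> l" "k \<le> m" "l \<le> m" for k l
        using that g h a
        by (intro commute_if_trivial_commutator_subgroup[OF is_group F2[OF that]])
          (auto simp: conj_set_def tel_image_def iota_phi_closed)
      have conj_p: "inv\<^bsub>\<Omega> m\<^esub> ?a \<otimes>\<^bsub>\<Omega> m\<^esub> ?p \<otimes>\<^bsub>\<Omega> m\<^esub> ?a =
          foldr (\<lambda>k y. (inv\<^bsub>\<Omega> m\<^esub> ?a \<otimes>\<^bsub>\<Omega> m\<^esub> \<iota> k m (\<phi> k g) \<otimes>\<^bsub>\<Omega> m\<^esub> ?a) \<otimes>\<^bsub>\<Omega> m\<^esub> y)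
            [Suc (Suc i)..<Suc m] \<one>\<^bsub>\<Omega> m\<^esub>"
        using m a g unfolding tel_tail_def
        by (simp del: upt_Suc) (rule conj_foldr_mult; auto simp: iota_phi_closed)
      have l: "(inv\<^bsub>\<Omega> m\<^esub> ?a \<otimes>\<^bsub>\<Omega> m\<^esub> ?p \<otimes>\<^bsub>\<Omega> m\<^esub> ?a) \<otimes>\<^bsub>\<Omega> m\<^esub> \<iota> l m (\<phi> l h)
          = \<iota> l m (\<phi> l h) \<otimes>\<^bsub>\<Omega> m\<^esub> (inv\<^bsub>\<Omega> m\<^esub> ?a \<otimes>\<^bsub>\<Omega> m\<^esub> ?p \<otimes>\<^bsub>\<Omega> m\<^esub> ?a)"
        if "i + 2 \<le> l" "l \<le> m" for l
        unfolding conj_p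
        by (rule foldr_mult_commute) (use that a g h kl in \<open>auto simp: iota_phi_closed\<close>)
      have r: "?r = foldr (\<lambda>l y. \<iota> l m (\<phi> l h) \<otimes>\<^bsub>\<Omega> m\<^esub> y) [Suc (Suc i)..<Suc m] \<one>\<^bsub>\<Omega> m\<^esub>"
        using m by (simp add: tel_tail_def del: upt_Suc)
      have "?r \<otimes>\<^bsub>\<Omega> m\<^esub> (inv\<^bsub>\<Omega> m\<^esub> ?a \<otimes>\<^bsub>\<Omega> m\<^esub> ?p \<otimes>\<^bsub>\<Omega> m\<^esub> ?a)
          = (inv\<^bsub>\<Omega> m\<^esub> ?a \<otimes>\<^bsub>\<Omega> m\<^esub> ?p \<otimes>\<^bsub>\<Omega> m\<^esub> ?a) \<otimes>\<^bsub>\<Omega> m\<^esub> ?r"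
        unfolding r
      proof (rule foldr_mult_commute)
        fix k assume "k \<in> set [Suc (Suc i)..<Suc m]"
        then have k: "i + 2 \<le> k" "k \<le> m" by auto
        then show "\<iota> k m (\<phi> k h) \<in> carrier (\<Omega> m)" using h by (simp add: iota_phi_closed)
        show "\<iota> k m (\<phi> k h) \<otimes>\<^bsub>\<Omega> m\<^esub> (inv\<^bsub>\<Omega> m\<^esub> ?a \<otimes>\<^bsub>\<Omega> m\<^esub> ?p \<otimes>\<^bsub>\<Omega> m\<^esub> ?a)
            = inv\<^bsub>\<Omega> m\<^esub> ?a \<otimes>\<^bsub>\<Omega> m\<^esub> ?p \<otimes>\<^bsub>\<Omega> m\<^esub> ?a \<otimes>\<^bsub>\<Omega> m\<^esub> \<iota> k m (\<phi> k h)"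
          using l[OF k] by (rule sym)
      qed (simp add: a pr)
      then show ?thesis by (rule sym)
    qed
    then have "commutator (\<Omega> m) (inv\<^bsub>\<Omega> m\<^esub> ?a \<otimes>\<^bsub>\<Omega> m\<^esub> (?b \<otimes>\<^bsub>\<Omega> m\<^esub> ?p) \<otimes>\<^bsub>\<Omega> m\<^esub> ?a) (?c \<otimes>\<^bsub>\<Omega> m\<^esub> ?r)
        = commutator (\<Omega> m) ?b ?c"
      using g h fixes_b tail_comm by (intro commutator_absorb a bc pr) auto
    also have "\<dots> = \<iota> (Suc i) m (\<phi> (Suc i) (commutator B g h))"
      using g h by (simp add: commutator_def)
    finally show ?thesis
      using lhs[OF m] 3 i m by (simp add: tail_split) (simp add: tel_diag_def)
  qed
qed

text \<open>The elements of \<open>B\<close> that are mapped into \<open>A\<close> form a subgroup containing all commutators.\<close>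

lemma diag_phi_mem:
  assumes "perfect_group B" and i: "1 \<le> i" and A: "subgroup A P"
    and comm: "\<And>g h. \<lbrakk>g \<in> carrier B; h \<in> carrier B\<rbrakk> \<Longrightarrow>
        diag (Suc i) (\<phi> (Suc i) (commutator B g h)) \<in> A"
    and g: "g \<in> carrier B"
  shows "diag (Suc i) (\<phi> (Suc i) g) \<in> A"
proof -
  interpret phi: group_hom B "\<Omega> (Suc i)" "\<phi> (Suc i)"
    using i by (intro phi_group_hom) auto
  interpret diag: group_hom "\<Omega> (Suc i)" P "diag (Suc i)"
    by (rule diag_group_hom) simp
  define T where "T = {g \<in> carrier B. diag (Suc i) (\<phi> (Suc i) g) \<in> A}"
  have "subgroup T B"
    by (rule phi.G.subgroupI)
      (use A in \<open>auto simp: T_def subgroup.m_inv_closed subgroup.m_closed subgroup.one_closed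
        simp del: mult_product_group inv_product_group one_product_group
        intro!: exI[of _ "\<one>\<^bsub>B\<^esub>"]\<close>)
  moreover have "derived_set B (carrier B) \<subseteq> T"
    using comm by (auto simp: T_def commutator_def)
  ultimately have "derived B (carrier B) \<subseteq> T"
    unfolding derived_def using phi.G.generate_subgroup_incl by blast
  then show ?thesis
    using assms(1) g by (auto simp: perfect_group_def T_def)
qed

text \<open>The generators of \<open>\<Omega> (Suc i)\<close> are conjugates of elements of \<open>\<phi> (Suc i) ` B\<close> by elements
  coming from \<open>\<Omega> i\<close>, and such a conjugation is carried out diagonally by elements of
  \<open>diag i ` \<Omega> i\<close>: these two diagonals only differ in coordinate \<open>i\<close>, where the conjugated
  element is trivial.\<close>

lemma diag_Suc_mem:
  assumes i: "1 \<le> i" and A: "subgroup A P"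
    and diag_i: "diag i ` carrier (\<Omega> i) \<subseteq> A"
    and diag_phi: "\<And>g. g \<in> carrier B \<Longrightarrow> diag (Suc i) (\<phi> (Suc i) g) \<in> A"
  shows "diag (Suc i) ` carrier (\<Omega> (Suc i)) \<subseteq> A"
proof -
  interpret iota: group_hom "\<Omega> i" "\<Omega> (Suc i)" "\<iota> i (Suc i)"
    using i by (intro iota_group_hom) auto
  interpret phi: group_hom B "\<Omega> (Suc i)" "\<phi> (Suc i)"
    using i by (intro phi_group_hom) auto
  interpret diag: group_hom "\<Omega> (Suc i)" P "diag (Suc i)"
    by (rule diag_group_hom) simp
  interpret diag0: group_hom "\<Omega> i" P "diag i"
    by (rule diag_group_hom[OF i])
  define T where "T = {\<omega> \<in> carrier (\<Omega> (Suc i)). diag (Suc i) \<omega> \<in> A}"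
  let ?X = "{h \<otimes>\<^bsub>\<Omega> (Suc i)\<^esub> b \<otimes>\<^bsub>\<Omega> (Suc i)\<^esub> inv\<^bsub>\<Omega> (Suc i)\<^esub> h | h b.
            h \<in> \<iota> i (Suc i) ` carrier (\<Omega> i) \<and> b \<in> \<phi> (Suc i) ` carrier B}"
  have T: "subgroup T (\<Omega> (Suc i))"
    by (rule iota.H.subgroupI)
      (use A in \<open>auto simp: T_def subgroup.m_inv_closed subgroup.m_closed subgroup.one_closed
        simp del: mult_product_group inv_product_group one_product_group
        intro!: exI[of _ "\<one>\<^bsub>\<Omega> (Suc i)\<^esub>"]\<close>)
  have "?X \<subseteq> T"
  proof clarify
    fix \<omega> g assume \<omega>: "\<omega> \<in> carrier (\<Omega> i)" and g: "g \<in> carrier B"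
    let ?h = "\<iota> i (Suc i) \<omega>" and ?b = "\<phi> (Suc i) g"
    let ?x = "?h \<otimes>\<^bsub>\<Omega> (Suc i)\<^esub> ?b \<otimes>\<^bsub>\<Omega> (Suc i)\<^esub> inv\<^bsub>\<Omega> (Suc i)\<^esub> ?h"
    have "diag (Suc i) ?x = diag i \<omega> \<otimes>\<^bsub>P\<^esub> diag (Suc i) ?b \<otimes>\<^bsub>P\<^esub> inv\<^bsub>P\<^esub> diag i \<omega>"
    proof
      fix m
      consider "m = 0" | "1 \<le> m" "m < Suc i" | "Suc i \<le> m" by linarith
      then show "diag (Suc i) ?x m =
          (diag i \<omega> \<otimes>\<^bsub>P\<^esub> diag (Suc i) ?b \<otimes>\<^bsub>P\<^esub> inv\<^bsub>P\<^esub> diag i \<omega>) m"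
      proof cases
        case 1
        then show ?thesis by (simp add: tel_diag_def)
      next
        case 2
        interpret group "\<Omega> m" by (rule group_Omega[OF 2(1)])
        have "diag i \<omega> m \<in> carrier (\<Omega> m)" using diag0.hom_closed[OF \<omega>] 2 by auto
        then show ?thesis
          using 2 diag0.hom_closed[OF \<omega>]
          by (simp add: inv_P_apply[OF diag0.hom_closed[OF \<omega>]]
              del: inv_product_group One_nat_def)
            (simp add: tel_diag_def iota_id)
      next
        case 3
        interpret sm: group_hom "\<Omega> (Suc i)" "\<Omega> m" "\<iota> (Suc i) m"
          using 3 by (intro iota_group_hom) auto
        have "\<iota> (Suc i) m ?h = \<iota> i m \<omega>"
          using i 3 \<omega> by (simp add: iota_iota)
        moreover have "diag (Suc i) ?x m = \<iota> (Suc i) m ?x"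
          using 3 by (subst tel_diag_def) simp
        ultimately show ?thesis
          using 3 i \<omega> g
          by (simp del: diag.hom_mult add: inv_P_apply[OF diag0.hom_closed[OF \<omega>]]
              del: inv_product_group One_nat_def)
            (simp add: tel_diag_def)
      qed
    qed
    also have "\<dots> \<in> A"
      using diag_i diag_phi[OF g] \<omega> A
      by (intro subgroup.m_closed[OF A] subgroup.m_inv_closed[OF A]) auto
    finally show "?x \<in> T"
      using \<omega> g by (simp add: T_def)
  qed
  then have "generate (\<Omega> (Suc i)) ?X \<subseteq> T"
    using T by (rule iota.H.generate_subgroup_incl)
  then have "carrier (\<Omega> (Suc i)) \<subseteq> T"
    using Omega_generated[of "Suc i"] i by simp
  then show ?thesis by (auto simp: T_def)
qed

text \<open>Dividing \<open>diag i \<omega>\<close> by \<open>diag (Suc i)\<close> of the image of \<open>\<omega>\<close> leaves only the entry \<open>\<omega>\<close> at \<open>i\<close>.\<close>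

lemma direct_sum_subset:
  assumes A: "subgroup A P" and diag: "\<And>i. 1 \<le> i \<Longrightarrow> diag i ` carrier (\<Omega> i) \<subseteq> A"
  shows "carrier (sum_group {1..} \<Omega>) \<subseteq> A"
proof
  have embed: "factor_embed {1..} \<Omega> i \<omega> \<in> A" if i: "1 \<le> i" and \<omega>: "\<omega> \<in> carrier (\<Omega> i)" for i \<omega>
  proof -
    let ?\<omega>' = "\<iota> i (Suc i) \<omega>"
    have \<omega>': "?\<omega>' \<in> carrier (\<Omega> (Suc i))" using i \<omega> by (simp add: iota_closed)
    have d: "diag (Suc i) ?\<omega>' \<in> carrier P"
      using group_hom.hom_closed[OF diag_group_hom[of "Suc i"] \<omega>'] by simp
    have "factor_embed {1..} \<Omega> i \<omega> = diag i \<omega> \<otimes>\<^bsub>P\<^esub> inv\<^bsub>P\<^esub> diag (Suc i) ?\<omega>'"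
    proof
      fix m
      consider "m = 0" | "1 \<le> m" "m < i" | "m = i" | "i < m" by linarith
      then show "factor_embed {1..} \<Omega> i \<omega> m = (diag i \<omega> \<otimes>\<^bsub>P\<^esub> inv\<^bsub>P\<^esub> diag (Suc i) ?\<omega>') m"
      proof cases
        case 1
        then show ?thesis by (simp add: factor_embed_def)
      next
        case 2
        then show ?thesis
          by (simp add: inv_P_apply[OF d] del: inv_product_group One_nat_def)
            (simp add: factor_embed_def tel_diag_def group_Omega group.is_monoid monoid.inv_one)
      next
        case 3
        then show ?thesis
          using i \<omega> by (simp add: inv_P_apply[OF d] del: inv_product_group One_nat_def)
            (simp add: factor_embed_def tel_diag_def group_Omega group.is_monoid monoid.inv_one
              iota_id)
      next
        case 4
        then show ?thesis
          using i \<omega> by (simp add: inv_P_apply[OF d] del: inv_product_group One_nat_def)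
            (simp add: factor_embed_def tel_diag_def group_Omega iota_iota iota_closed group.r_inv)
      qed
    qed
    also have "\<dots> \<in> A"
      using diag[OF i] diag[of "Suc i"] \<omega> \<omega>'
      by (intro subgroup.m_closed[OF A] subgroup.m_inv_closed[OF A]) auto
    finally show ?thesis .
  qed
  have fc: "factor_closed {1..} \<Omega> A"
    using embed by (auto simp: factor_closed_def)
  fix x assume "x \<in> carrier (sum_group {1..} \<Omega>)"
  then have x: "x \<in> carrier P" "finite {i \<in> {1..}. x i \<noteq> \<one>\<^bsub>\<Omega> i\<^esub>}"
    using carrier_sum_group[of "{1..}" \<Omega>] group_Omega by auto
  show "x \<in> A"
  proof (rule finite_support_mem[OF _ A fc])
    show "\<exists>h\<in>A. h i \<noteq> \<one>\<^bsub>\<Omega> i\<^esub>" if i: "i \<in> {1..}" and xi: "x i \<noteq> \<one>\<^bsub>\<Omega> i\<^esub>" for i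
    proof
      show "factor_embed {1..} \<Omega> i (x i) \<in> A"
        using embed[of i "x i"] i x(1) by auto
      show "factor_embed {1..} \<Omega> i (x i) i \<noteq> \<one>\<^bsub>\<Omega> i\<^esub>"
        using i xi by (simp add: factor_embed_def)
    qed
  qed (use x group_Omega in auto)
qed

end

section \<open>Flexible telescopes over perfect groups\<close>

context flexible_telescope
begin

text \<open>The induction has to carry the tails along: the tail at \<open>i\<close> is needed to reach level \<open>Suc i\<close>,
  and dividing it by its leading diagonal factor yields the next tail.\<close>

lemma diag_subset_if_perfect:
  assumes perfect: "perfect_group B" and A: "subgroup A P"
    and base: "diag 1 ` carrier (\<Omega> 1) \<subseteq> A" "tail 1 ` carrier B \<subseteq> A"
    and i: "1 \<le> i"
  shows "diag i ` carrier (\<Omega> i) \<subseteq> A"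
proof -
  obtain \<alpha> where \<alpha>: "\<And>i. 1 \<le> i \<Longrightarrow> \<alpha> i \<in> carrier (\<Omega> i)"
    and F1: "\<And>i. 1 \<le> i \<Longrightarrow> commutator_subgroup (\<Omega> (i + 1))
       {\<iota> i (i + 1) (\<alpha> i)} (\<phi> (i + 1) ` carrier B) = {\<one>\<^bsub>\<Omega> (i + 1)\<^esub>}"
    and F2: "\<And>i k l m. \<lbrakk>1 \<le> i; i + 2 \<le> k; i + 2 \<le> l; k \<le> m; l \<le> m\<rbrakk> \<Longrightarrow>
       commutator_subgroup (\<Omega> m) (conj_set (\<Omega> m) (tel_image B \<iota> \<phi> k m) (\<iota> i m (\<alpha> i)))
         (tel_image B \<iota> \<phi> l m) = {\<one>\<^bsub>\<Omega> m\<^esub>}"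
    using flexible by metis
  have "diag i ` carrier (\<Omega> i) \<subseteq> A \<and> tail i ` carrier B \<subseteq> A"
    using i
  proof (induction i rule: nat_induct_at_least)
    case base
    show ?case using assms(3,4) by simp
  next
    case (Suc i)
    have comm: "diag (Suc i) (\<phi> (Suc i) (commutator B g h)) \<in> A"
      if "g \<in> carrier B" "h \<in> carrier B" for g h
    proof -
      have "diag i (\<alpha> i) \<in> A" "tail i g \<in> A" "tail i h \<in> A"
        using Suc that \<alpha> by auto
      then have "commutator P (inv\<^bsub>P\<^esub> (diag i (\<alpha> i)) \<otimes>\<^bsub>P\<^esub> tail i g \<otimes>\<^bsub>P\<^esub> diag i (\<alpha> i)) (tail i h) \<in> A"
        unfolding commutator_def
        by (intro subgroup.m_closed[OF A] subgroup.m_inv_closed[OF A])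
      then show ?thesis
        using tail_commutator[OF Suc.hyps \<alpha>[OF Suc.hyps] F1[OF Suc.hyps] F2[OF Suc.hyps] that]
        by simp
    qed
    have diag_phi: "diag (Suc i) (\<phi> (Suc i) g) \<in> A" if "g \<in> carrier B" for g
      using perfect Suc.hyps A comm that by (rule diag_phi_mem)
    have "tail (Suc i) g \<in> A" if g: "g \<in> carrier B" for g
    proof -
      interpret P: group P by (rule group_P)
      have "diag (Suc i) (\<phi> (Suc i) g) \<in> carrier P"
        using subgroup.subset[OF A] diag_phi[OF g] by blast
      moreover have "tail (Suc i) g \<in> carrier P"
        using g by (intro tail_closed) simp_all
      ultimately have "tail (Suc i) g = inv\<^bsub>P\<^esub> (diag (Suc i) (\<phi> (Suc i) g)) \<otimes>\<^bsub>P\<^esub> tail i g"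
        using P.inv_solve_left[of "tail (Suc i) g" "diag (Suc i) (\<phi> (Suc i) g)" "tail i g"]
          tail_closed[OF Suc.hyps g] tail_eq_diag_mult[OF Suc.hyps g]
        by blast
      moreover have "tail i g \<in> A" using Suc.IH g by blast
      ultimately show ?thesis
        using diag_phi[OF g] subgroup.m_closed[OF A] subgroup.m_inv_closed[OF A] by metis
    qed
    then show ?case
      using diag_Suc_mem[OF Suc.hyps A _ diag_phi] Suc.IH by blast
  qed
  then show ?thesis ..
qed

lemma diag_subset_tel_group:
  assumes "perfect_group B" and "1 \<le> i"
  shows "diag i ` carrier (\<Omega> i) \<subseteq> carrier (tel_group B \<Omega> \<iota> \<phi>)"
proof -
  interpret P: group P by (rule group_P)
  let ?A = "carrier (tel_group B \<Omega> \<iota> \<phi>)"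
  have A: "subgroup ?A P"
    unfolding tel_group_def by (rule P.subgroup_subgroup_generated)
  have "diag 1 ` carrier (\<Omega> 1) \<union> tel_tilde \<Omega> \<iota> \<phi> ` carrier B \<subseteq> ?A"
    unfolding tel_group_def
  proof (rule P.subgroup_generated_subset_carrier_subset)
    show "diag 1 ` carrier (\<Omega> 1) \<union> tel_tilde \<Omega> \<iota> \<phi> ` carrier B \<subseteq> carrier P"
      using group_hom.hom_closed[OF diag_group_hom[of 1]] tail_closed[of 1]
      by (auto simp: tel_tilde_eq_tail simp del: carrier_product_group)
  qed
  then show ?thesis
    by (intro diag_subset_if_perfect[OF assms(1) A _ _ assms(2)]) (simp_all add: tel_tilde_eq_tail)
qed

lemma tel_group_eq_huge_group:
  assumes "perfect_group B"
  shows "tel_group B \<Omega> \<iota> \<phi> = tel_huge_group B \<Omega> \<iota> \<phi>"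
proof -
  interpret P: group P by (rule group_P)
  let ?S = "diag 1 ` carrier (\<Omega> 1) \<union> tel_tilde \<Omega> \<iota> \<phi> ` carrier B"
  let ?S' = "(\<Union>i\<in>{1..}. diag i ` carrier (\<Omega> i)) \<union> tel_tilde \<Omega> \<iota> \<phi> ` carrier B"
  let ?A = "generate P (carrier P \<inter> ?S)"
  have A: "?A = carrier (tel_group B \<Omega> \<iota> \<phi>)"
    by (simp add: tel_group_def carrier_subgroup_generated)
  have "carrier P \<inter> ?S' \<subseteq> ?A"
  proof
    fix x assume x: "x \<in> carrier P \<inter> ?S'"
    then consider i where "1 \<le> i" "x \<in> diag i ` carrier (\<Omega> i)"
      | "x \<in> carrier P \<inter> tel_tilde \<Omega> \<iota> \<phi> ` carrier B"
      by blast
    then show "x \<in> ?A"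
    proof cases
      case 1
      then show ?thesis unfolding A using diag_subset_tel_group[OF assms] by blast
    next
      case 2
      then show ?thesis by (intro generate.incl) blast
    qed
  qed
  then have "generate P (carrier P \<inter> ?S') \<subseteq> ?A"
    by (intro P.generate_subgroup_incl P.generate_is_subgroup) auto
  moreover have "?A \<subseteq> generate P (carrier P \<inter> ?S')"
    by (rule P.mono_generate) auto
  ultimately show ?thesis
    by (auto simp: tel_group_def tel_huge_group_def subgroup_generated_def)
qed

end

section \<open>The group of a flexible telescope with simple head\<close>

theorem theorem4p3:
  fixes B :: "('b, 'n) monoid_scheme"
    and \<Omega> :: "nat \<Rightarrow> ('a, 'm) monoid_scheme"
    and \<iota> :: "nat \<Rightarrow> nat \<Rightarrow> 'a \<Rightarrow> 'a"
    and \<phi> :: "nat \<Rightarrow> 'b \<Rightarrow> 'a"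
  assumes "finitely_generated B"
    and "perfect_group B"
    and "flexible_telescope B \<Omega> \<iota> \<phi>"
    and "\<And>i. 1 \<le> i \<Longrightarrow> finitely_generated (\<Omega> i)"
    and "\<And>i. 1 \<le> i \<Longrightarrow> \<not> comm_group (\<Omega> i)"
    and "\<And>i. 1 \<le> i \<Longrightarrow> simple_grp (\<Omega> i)"
    and "simple_grp (tel_head B \<Omega> \<iota> \<phi>)"
  shows "t_group (tel_group B \<Omega> \<iota> \<phi>)"
proof -
  interpret flexible_telescope B \<Omega> \<iota> \<phi> by (rule assms(3))
  interpret P: group P by (rule group_P)
  define A where "A = carrier (tel_group B \<Omega> \<iota> \<phi>)"
  have G: "tel_group B \<Omega> \<iota> \<phi> = P\<lparr>carrier := A\<rparr>"
    by (simp add: A_def tel_group_def subgroup_generated_def)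
  have A: "subgroup A P"
    unfolding A_def tel_group_def by (rule P.subgroup_subgroup_generated)
  have "carrier (sum_group {1..} \<Omega>) \<subseteq> A"
    using diag_subset_tel_group[OF assms(2)] unfolding A_def[symmetric]
    by (rule direct_sum_subset[OF A])
  moreover have "simple_grp (P\<lparr>carrier := A\<rparr> Mod carrier (sum_group {1..} \<Omega>))"
    using assms(7) unfolding tel_head_def tel_group_eq_huge_group[OF assms(2), symmetric] G .
  ultimately show ?thesis
    unfolding G using A assms(5,6) by (intro t_group_extending_direct_sum) auto
qed

end
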